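(* Let $N=\{1,\dots,n\}$ be a set of agents with $n\ge 2$, let $X$ be a finite set with $|X|\ge 3$, and let $\mathcal{P}$ be the set of all strict preferences over $X$. Let $f,g:\mathcal{P}^n\to X$ be tops-only rules. Then $f$ is at least as dictatorial as $g$ if and only if $g$ is at least as manipulable as $f$; that is, $|D_f|\ge|D_g|$ if and only if $|M_g|\ge|M_f|$, where $D_h$ and $M_h$ denote, respectively, the sets of dictatorial and of manipulable profiles for a rule $h$.
   Context: A strict preference $P_i$ over $X$ is a strict linear order on $X$ ($xP_iy$ means $x$ is strictly preferred to $y$); its top $t(P_i)$ is its best alternative. A profile is $P=(P_1,\dots,P_n)\in\mathcal{P}^n$; $(P_i',P_{-i})$ denotes the profile obtained from $P$ by replacing $P_i$ with $P_i'$. A (social choice) rule is a function $f:\mathcal{P}^n\to X$; as a standing assumption, rules are unanimous, i.e., $f(P)=x$ whenever $t(P_i)=x$ for each $i\in N$. - $f$ is tops-only if $f(P)=f(P')$ for all $P,P'\in\mathcal{P}^n$ with $t(P_i)=t(P_i')$ for each $i\in N$. - Agent $i$ manipulates $f$ at $P$ via $P_i'\in\mathcal{P}$ if $f(P_i',P_{-i})\,P_i\,f(P)$. - For a tops-only rule $f$, profile $P$ is manipulable for $f$ if there are $i\in N$ and $P_i^\star,P_i'\in\mathcal{P}$ such that $t(P_i^\star)=t(P_i)$ and $i$ manipulates $f$ at $(P_i^\star,P_{-i})$ via $P_i'$. $M_f$ is the set of all manipulable profiles for $f$. - Profile $P$ is dictatorial for $f$ if, for each $i\in N$ such that $t(P_i)\ne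 f(P)$, we have $f(P_i',P_{-i})=f(P)$ for each $P_i'\in\mathcal{P}$. $D_f$ is the set of all dictatorial profiles for $f$. - $f$ is at least as manipulable as $g$ if $|M_f|\ge|M_g|$; $f$ is at least as dictatorial as $g$ if $|D_f|\ge|D_g|$. *)

theory Defs
  imports Main "HOL-Library.FuncSet"
begin

text \<open>
  A strict preference over \<open>X\<close> is a relation in which \<open>(x, y)\<close> means that \<open>x\<close> is strictly
  preferred to \<open>y\<close>. The inclusion in \<open>X \<times> X\<close> makes each preference on \<open>X\<close> a single
  object, so that counting profiles is meaningful.
\<close>

definition preferences :: "'a set \<Rightarrow> 'a rel set" where
  "preferences X = {R. R \<subseteq> X \<times> X \<and> strict_linear_order_on X R}"

definition top_alt :: "'a set \<Rightarrow> 'a rel \<Rightarrow> 'a" where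
  "top_alt X R = (THE x. x \<in> X \<and> (\<forall>y\<in>X. y \<noteq> x \<longrightarrow> (x, y) \<in> R))"

type_synonym 'a profile = "nat \<Rightarrow> 'a rel"

text \<open>
  The agents are \<open>1, \<dots>, n\<close>. Profiles are extensional functions; the profile obtained from
  \<open>P\<close> by replacing the preference of agent \<open>i\<close> with \<open>R\<close> is \<open>P(i := R)\<close>. A rule is a
  function on all of \<open>'a profile\<close>, but only its values on \<open>profiles n X\<close> matter.
\<close>

definition profiles :: "nat \<Rightarrow> 'a set \<Rightarrow> 'a profile set" where
  "profiles n X = ({1..n} \<rightarrow>\<^sub>E preferences X)"

definition unanimous :: "nat \<Rightarrow> 'a set \<Rightarrow> ('a profile \<Rightarrow> 'a) \<Rightarrow> bool" where
  "unanimous n X f \<longleftrightarrow>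
    (\<forall>P\<in>profiles n X. \<forall>x\<in>X. (\<forall>i\<in>{1..n}. top_alt X (P i) = x) \<longrightarrow> f P = x)"

definition choice_rule :: "nat \<Rightarrow> 'a set \<Rightarrow> ('a profile \<Rightarrow> 'a) \<Rightarrow> bool" where
  "choice_rule n X f \<longleftrightarrow> f \<in> profiles n X \<rightarrow> X \<and> unanimous n X f"

definition tops_only :: "nat \<Rightarrow> 'a set \<Rightarrow> ('a profile \<Rightarrow> 'a) \<Rightarrow> bool" where
  "tops_only n X f \<longleftrightarrow>
    (\<forall>P\<in>profiles n X. \<forall>P'\<in>profiles n X.
      (\<forall>i\<in>{1..n}. top_alt X (P i) = top_alt X (P' i)) \<longrightarrow> f P = f P')"

definition manipulates :: "('a profile \<Rightarrow> 'a) \<Rightarrow> nat \<Rightarrow> 'a profile \<Rightarrow> 'a rel \<Rightarrow> bool" where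
  "manipulates f i P R' \<longleftrightarrow> (f (P(i := R')), f P) \<in> P i"

definition manipulable_profiles :: "nat \<Rightarrow> 'a set \<Rightarrow> ('a profile \<Rightarrow> 'a) \<Rightarrow> 'a profile set" where
  "manipulable_profiles n X f =
    {P \<in> profiles n X. \<exists>i\<in>{1..n}. \<exists>R\<in>preferences X. \<exists>R'\<in>preferences X.
      top_alt X R = top_alt X (P i) \<and> manipulates f i (P(i := R)) R'}"

definition dictatorial_profiles :: "nat \<Rightarrow> 'a set \<Rightarrow> ('a profile \<Rightarrow> 'a) \<Rightarrow> 'a profile set" where
  "dictatorial_profiles n X f =
    {P \<in> profiles n X. \<forall>i\<in>{1..n}. top_alt X (P i) \<noteq> f P \<longrightarrow>
      (\<forall>R'\<in>preferences X. f (P(i := R')) = f P)}"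

definition at_least_as_manipulable ::
    "nat \<Rightarrow> 'a set \<Rightarrow> ('a profile \<Rightarrow> 'a) \<Rightarrow> ('a profile \<Rightarrow> 'a) \<Rightarrow> bool" where
  "at_least_as_manipulable n X f g \<longleftrightarrow>
    card (manipulable_profiles n X f) \<ge> card (manipulable_profiles n X g)"

definition at_least_as_dictatorial ::
    "nat \<Rightarrow> 'a set \<Rightarrow> ('a profile \<Rightarrow> 'a) \<Rightarrow> ('a profile \<Rightarrow> 'a) \<Rightarrow> bool" where
  "at_least_as_dictatorial n X f g \<longleftrightarrow>
    card (dictatorial_profiles n X f) \<ge> card (dictatorial_profiles n X g)"

end

theory Submission
  imports Defs
begin

text \<open>
  For a tops-only rule, the manipulable profiles are exactly the non-dictatorial ones: if an agent
  whose top differs from the outcome \<open>x\<close> can change it to \<open>y\<close>, then, as \<open>x\<close> is not the top, some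
  preference with the same top ranks \<open>y\<close> above \<open>x\<close>. Both counts therefore add up to the number
  of profiles.
\<close>

lemma top_alt_eqI:
  assumes "R \<in> preferences X" "x \<in> X" "\<And>y. y \<in> X \<Longrightarrow> y \<noteq> x \<Longrightarrow> (x, y) \<in> R"
  shows "top_alt X R = x"
  unfolding top_alt_def
proof (rule the_equality)
  fix z assume z: "z \<in> X \<and> (\<forall>y\<in>X. y \<noteq> z \<longrightarrow> (z, y) \<in> R)"
  have "trans R" "irrefl R"
    using assms(1) by (auto simp: preferences_def strict_linear_order_on_def)
  \<comment> \<open>If \<open>z\<close> differed from \<open>x\<close>, each would be ranked above
    the other, against transitivity and irreflexivity.\<close>
  with z assms show "z = x"
    by (metis irreflD transD)
qed (use assms in auto)

text \<open>A strict order on a finite set is well-founded. Since the better alternative is the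
  first component of a pair, a minimal element is one that nothing beats, and totality makes it the
  top.\<close>

lemma top_alt_greatest:
  assumes "finite X" "X \<noteq> {}" "R \<in> preferences X"
  shows "top_alt X R \<in> X" "\<And>y. (y, top_alt X R) \<notin> R"
proof -
  have R: "R \<subseteq> X \<times> X" "trans R" "irrefl R" "total_on X R"
    using assms(3) by (auto simp: preferences_def strict_linear_order_on_def)
  have "finite R"
    using R(1) assms(1) by (meson finite_SigmaI finite_subset)
  moreover have "acyclic R"
    using R by (simp add: acyclic_irrefl)
  ultimately have "wf R"
    by (rule finite_acyclic_wf)
  moreover obtain a where "a \<in> X"
    using assms(2) by auto
  ultimately obtain x where x: "x \<in> X" "\<And>z. (z, x) \<in> R \<Longrightarrow> z \<notin> X"
    by (metis wfE_min)
  have "top_alt X R = x"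
    using x R(4) by (intro top_alt_eqI assms) (auto simp: total_on_def)
  with x R(1) show "top_alt X R \<in> X" "\<And>y. (y, top_alt X R) \<notin> R"
    by auto
qed

lemma ranking_in_preferences:
  fixes r :: "'a \<Rightarrow> nat"
  assumes "inj_on r X"
  shows "{(a, b). a \<in> X \<and> b \<in> X \<and> r a < r b} \<in> preferences X"
  using assms
  by (auto simp: preferences_def strict_linear_order_on_def trans_def irrefl_def total_on_def
      inj_on_def) (metis linorder_neqE_nat)

text \<open>Supplies the preference that makes a change of outcome from \<open>x\<close> to
  \<open>y\<close> profitable without altering the reported top \<open>t\<close>. The case
  \<open>y = t\<close> is included.\<close>

lemma ex_preference_with_top:
  assumes "finite X" "t \<in> X" "x \<in> X" "y \<in> X" "x \<noteq> t" "x \<noteq> y"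
  obtains R where "R \<in> preferences X" "top_alt X R = t" "(y, x) \<in> R"
proof -
  obtain h :: "'a \<Rightarrow> nat" where h: "inj_on h X"
    using finite_imp_inj_to_nat_seg[OF assms(1)] by blast
  \<comment> \<open>Smaller rank means better. The shift by 2 reserves ranks 0 and 1 for
    \<open>t\<close> and \<open>y\<close>, so \<open>r\<close> stays injective; \<open>x\<close> is
    neither of them and has rank at least 2.\<close>
  define r where "r z = (if z = t then 0 else if z = y then 1 else h z + 2)" for z
  define R where "R = {(a, b). a \<in> X \<and> b \<in> X \<and> r a < r b}"
  have "inj_on r X"
    using h by (auto simp: inj_on_def r_def)
  then have R: "R \<in> preferences X"
    unfolding R_def by (rule ranking_in_preferences)
  moreover have "top_alt X R = t"
    using R assms by (intro top_alt_eqI) (auto simp: R_def r_def)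
  moreover have "(y, x) \<in> R"
    using assms by (auto simp: R_def r_def)
  ultimately show ?thesis by (rule that)
qed

lemma profiles_fun_upd:
  assumes "P \<in> profiles n X" "i \<in> {1..n}" "R \<in> preferences X"
  shows "P(i := R) \<in> profiles n X"
  using assms by (auto simp: profiles_def PiE_iff extensional_def)

lemma manipulable_eq_not_dictatorial:
  assumes "finite X" and f: "f \<in> profiles n X \<rightarrow> X" and tops: "tops_only n X f"
  shows "manipulable_profiles n X f = profiles n X - dictatorial_profiles n X f"
proof -
  have "P \<in> manipulable_profiles n X f \<longleftrightarrow> P \<notin> dictatorial_profiles n X f"
    if P: "P \<in> profiles n X" for P
  proof -
    have fP: "f P \<in> X"
      using f P by auto
    \<comment> \<open>Only the top of \<open>R\<close> matters for the outcome, so a manipulation at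
      \<open>P(i := R)\<close> via \<open>R'\<close> amounts to \<open>R\<close> ranking
      \<open>f (P(i := R'))\<close> above \<open>f P\<close>.\<close>
    have same: "f (P(i := R)) = f P"
      if "i \<in> {1..n}" "R \<in> preferences X" "top_alt X R = top_alt X (P i)" for i R
      using that P tops profiles_fun_upd[OF P that(1,2)] unfolding tops_only_def
      by (metis fun_upd_apply)
    \<comment> \<open>The equivalence is proved agent by agent: \<open>?D\<close> is the negation of
      the condition that being dictatorial imposes on agent \<open>i\<close>.\<close>
    have "(\<exists>R\<in>preferences X. \<exists>R'\<in>preferences X.
        top_alt X R = top_alt X (P i) \<and> manipulates f i (P(i := R)) R') \<longleftrightarrow>
      top_alt X (P i) \<noteq> f P \<and> (\<exists>R'\<in>preferences X. f (P(i := R')) \<noteq> f P)" (is "?M \<longleftrightarrow> ?D")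
      if i: "i \<in> {1..n}" for i
    proof
      assume ?M
      then obtain R R' where R: "R \<in> preferences X" "R' \<in> preferences X"
        "top_alt X R = top_alt X (P i)" "(f (P(i := R')), f P) \<in> R"
        using same[OF i] by (auto simp: manipulates_def)
      have "irrefl R"
        using R(1) by (auto simp: preferences_def strict_linear_order_on_def)
      \<comment> \<open>\<open>R\<close> ranks something above \<open>f P\<close>, so
        \<open>f P\<close> is not its top, which is also the top of \<open>P i\<close>;
        irreflexivity separates the two outcomes.\<close>
      then show ?D
        using R top_alt_greatest(2)[OF assms(1) _ R(1)] fP by (metis emptyE irreflD)
    next
      assume ?D
      then obtain R' where R': "R' \<in> preferences X" "f (P(i := R')) \<noteq> f P"
        and top: "top_alt X (P i) \<noteq> f P" by auto
      have "P i \<in> preferences X"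
        using P i by (auto simp: profiles_def)
      then have "top_alt X (P i) \<in> X"
        using top_alt_greatest(1) assms(1) fP by blast
      moreover have "f (P(i := R')) \<in> X"
        using f profiles_fun_upd[OF P i R'(1)] by auto
      ultimately obtain R where "R \<in> preferences X" "top_alt X R = top_alt X (P i)"
        "(f (P(i := R')), f P) \<in> R"
        using ex_preference_with_top[OF assms(1) _ fP] top R'(2) by metis
      then show ?M
        using R'(1) same[OF i] unfolding manipulates_def fun_upd_upd fun_upd_same by metis
    qed
    then show ?thesis
      using P by (auto simp: manipulable_profiles_def dictatorial_profiles_def)
  qed
  then show ?thesis
    by (auto simp: manipulable_profiles_def)
qed

lemma finite_profiles:
  assumes "finite X"
  shows "finite (profiles n X)"
proof -
  have "preferences X \<subseteq> Pow (X \<times> X)"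
    by (auto simp: preferences_def)
  then have "finite (preferences X)"
    using assms by (meson finite_Pow_iff finite_SigmaI finite_subset)
  then show ?thesis
    by (auto simp: profiles_def intro: finite_PiE)
qed

lemma card_manipulable_plus_dictatorial:
  assumes "finite X" "choice_rule n X f" "tops_only n X f"
  shows "card (manipulable_profiles n X f) + card (dictatorial_profiles n X f)
    = card (profiles n X)"
proof -
  have "dictatorial_profiles n X f \<subseteq> profiles n X"
    by (auto simp: dictatorial_profiles_def)
  moreover have "manipulable_profiles n X f = profiles n X - dictatorial_profiles n X f"
    using assms by (intro manipulable_eq_not_dictatorial) (auto simp: choice_rule_def)
  ultimately show ?thesis
    using finite_profiles[OF assms(1)]
    by (metis card_Diff_subset card_mono finite_subset le_add_diff_inverse2)
qed

theorem corollary2: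
  fixes n :: nat and X :: "'a set" and f g :: "'a profile \<Rightarrow> 'a"
  assumes "n \<ge> 2"
    and "finite X" and "card X \<ge> 3"
    and "choice_rule n X f" and "tops_only n X f"
    and "choice_rule n X g" and "tops_only n X g"
  shows "at_least_as_dictatorial n X f g \<longleftrightarrow> at_least_as_manipulable n X g f"
  \<comment> \<open>Both sums equal \<open>card (profiles n X)\<close>, a total independent of the
    rule, so a larger dictatorial count is the same as a smaller manipulable one.\<close>
  using card_manipulable_plus_dictatorial[of X n f] card_manipulable_plus_dictatorial[of X n g] assms
  by (auto simp: at_least_as_dictatorial_def at_least_as_manipulable_def)

end
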